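(* Let $(X,d)$ be an ultrametric space. Then the following statements are equivalent: (1) The space $(X,d)$ is locally compact. (2) The space $(\bar{\mathbf{B}}_X, d_H)$ is locally compact.
   Context: Metric spaces are nonempty. An ultrametric space is a metric space $(X,d)$ with $d(x,y)\le\max\{d(x,z),d(z,y)\}$ for all $x,y,z\in X$. For $c\in X$ and $r\ge 0$ the closed ball is $\bar B_r(c)=\{x\in X: d(c,x)\le r\}$ (so $\bar B_0(c)=\{c\}$). $\bar{\mathbf{B}}_X$ is the set of all closed balls $\bar B_r(c)$, $c\in X$, $r\ge 0$, regarded as subsets of $X$. The Hausdorff distance between nonempty closed bounded sets $A,B\subseteq X$ is $d_H(A,B)=\max\{\sup_{a\in A}\inf_{b\in B}d(a,b),\ \sup_{b\in B}\inf_{a\in A}d(a,b)\}$; $\bar{\mathbf{B}}_X$ is equipped with the metric $d_H$. A metric space $Y$ is locally compact if for each $y\in Y$ there is $r>0$ such that the closed ball of radius $r$ centered at $y$ is a compact subset of $Y$. *)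

theory Defs
  imports "HOL-Analysis.Analysis"
begin

locale Ultrametric_space = Metric_space +
  assumes ultrametric: "\<lbrakk>x \<in> M; y \<in> M; z \<in> M\<rbrakk> \<Longrightarrow> d x y \<le> max (d x z) (d z y)"

context Metric_space
begin

definition closed_balls :: "'a set set"
  where "closed_balls = {mcball c r | c r. c \<in> M \<and> 0 \<le> r}"

definition closed_bounded_sets :: "'a set set"
  where "closed_bounded_sets = {A. A \<noteq> {} \<and> closedin mtopology A \<and> mbounded A}"

text \<open>The Hausdorff distance is meaningful only for nonempty closed bounded sets. Elsewhere it gets
  the value 0, because the locale \<^locale>\<open>Metric_space\<close> requires nonnegativity and symmetry of a
  distance function on the whole type, not just on the carrier.\<close>

definition hausdorff_dist :: "'a set \<Rightarrow> 'a set \<Rightarrow> real"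
  where "hausdorff_dist A B =
    (if A \<in> closed_bounded_sets \<and> B \<in> closed_bounded_sets
     then max (SUP a\<in>A. INF b\<in>B. d a b) (SUP b\<in>B. INF a\<in>A. d a b)
     else 0)"

definition locally_compact_metric :: bool
  where "locally_compact_metric \<longleftrightarrow> (\<forall>y\<in>M. \<exists>r>0. compactin mtopology (mcball y r))"

lemma locally_compact_metric_iff: "locally_compact_metric \<longleftrightarrow> locally_compact_space mtopology"
proof
  assume lc: locally_compact_metric
  show "locally_compact_space mtopology"
    unfolding locally_compact_space_def
  proof
    fix y assume "y \<in> topspace mtopology"
    then have y: "y \<in> M" by simp
    with lc obtain r where "r > 0" "compactin mtopology (mcball y r)"
      unfolding locally_compact_metric_def by blast
    with y show "\<exists>U K. openin mtopology U \<and> compactin mtopology K \<and> y \<in> U \<and> U \<subseteq> K"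
      by (intro exI[of _ "mball y r"] exI[of _ "mcball y r"]) auto
  qed
next
  assume lc: "locally_compact_space mtopology"
  show locally_compact_metric
    unfolding locally_compact_metric_def
  proof
    fix y assume "y \<in> M"
    with lc obtain U K where UK: "openin mtopology U" "compactin mtopology K" "y \<in> U" "U \<subseteq> K"
      unfolding locally_compact_space_def by auto
    then obtain r where r: "r > 0" "mcball y r \<subseteq> U"
      by (meson openin_mtopology_mcball)
    then have "compactin mtopology (mcball y r)"
      by (meson UK closed_compactin closedin_mcball subset_trans)
    with r show "\<exists>r>0. compactin mtopology (mcball y r)" by blast
  qed
qed

lemma closed_balls_subset: "closed_balls \<subseteq> closed_bounded_sets"
  by (auto simp: closed_balls_def closed_bounded_sets_def mbounded_mcball)

lemma closed_bounded_sets_subset: "A \<in> closed_bounded_sets \<Longrightarrow> A \<subseteq> M"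
  by (simp add: closed_bounded_sets_def mbounded_subset_mspace)

lemma bdd_below_d: "bdd_below (d a ` B)"
  by (auto intro!: bdd_belowI[of _ 0])

lemma INF_d_nonneg: "B \<noteq> {} \<Longrightarrow> 0 \<le> (INF b\<in>B. d a b)"
  by (auto intro: cINF_greatest)

lemma bdd_above_INF_d:
  assumes "A \<in> closed_bounded_sets" "B \<in> closed_bounded_sets"
  shows "bdd_above ((\<lambda>a. INF b\<in>B. d a b) ` A)"
proof -
  have AB: "A \<subseteq> M" "B \<subseteq> M" "B \<noteq> {}" "mbounded (A \<union> B)"
    using assms by (simp_all add: closed_bounded_sets_def mbounded_Un mbounded_subset_mspace)
  then obtain C where C: "\<And>x y. \<lbrakk>x \<in> A \<union> B; y \<in> A \<union> B\<rbrakk> \<Longrightarrow> d x y \<le> C"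
    unfolding mbounded_alt by blast
  obtain b where "b \<in> B" using AB by blast
  then have "(INF b\<in>B. d a b) \<le> C" if "a \<in> A" for a
    using C[of a b] that by (intro cINF_lower2[OF bdd_below_d, of b]) auto
  then show ?thesis by (auto intro!: bdd_aboveI[of _ C])
qed

lemma half_hausdorff_nonneg:
  assumes "A \<in> closed_bounded_sets" "B \<in> closed_bounded_sets"
  shows "0 \<le> (SUP a\<in>A. INF b\<in>B. d a b)"
proof -
  obtain a where "a \<in> A" "B \<noteq> {}" using assms by (auto simp: closed_bounded_sets_def)
  then show ?thesis
    by (intro cSUP_upper2[OF bdd_above_INF_d[OF assms], of a] INF_d_nonneg)
qed

lemma half_hausdorff_triangle:
  assumes A: "A \<in> closed_bounded_sets" and B: "B \<in> closed_bounded_sets" and C: "C \<in> closed_bounded_sets"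
  shows "(SUP a\<in>A. INF c\<in>C. d a c) \<le> (SUP a\<in>A. INF b\<in>B. d a b) + (SUP b\<in>B. INF c\<in>C. d b c)"
proof (rule cSUP_least)
  show "A \<noteq> {}" using A by (auto simp: closed_bounded_sets_def)
next
  fix a assume a: "a \<in> A"
  have ne: "B \<noteq> {}" "C \<noteq> {}" using B C by (auto simp: closed_bounded_sets_def)
  have "(INF c\<in>C. d a c) - (SUP b\<in>B. INF c\<in>C. d b c) \<le> (INF b\<in>B. d a b)"
  proof (rule cINF_greatest[OF ne(1)])
    fix b assume b: "b \<in> B"
    have "(INF c\<in>C. d a c) - d a b \<le> (INF c\<in>C. d b c)"
    proof (rule cINF_greatest[OF ne(2)])
      fix c assume c: "c \<in> C"
      have "(INF c\<in>C. d a c) \<le> d a c" by (rule cINF_lower[OF bdd_below_d c])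
      moreover have "d a c \<le> d a b + d b c"
        using a b c A B C by (meson closed_bounded_sets_subset subsetD triangle)
      ultimately show "(INF c\<in>C. d a c) - d a b \<le> d b c" by simp
    qed
    also have "\<dots> \<le> (SUP b\<in>B. INF c\<in>C. d b c)"
      by (rule cSUP_upper[OF b bdd_above_INF_d[OF B C]])
    finally show "(INF c\<in>C. d a c) - (SUP b\<in>B. INF c\<in>C. d b c) \<le> d a b" by simp
  qed
  also have "\<dots> \<le> (SUP a\<in>A. INF b\<in>B. d a b)"
    by (rule cSUP_upper[OF a bdd_above_INF_d[OF A B]])
  finally show "(INF c\<in>C. d a c) \<le> (SUP a\<in>A. INF b\<in>B. d a b) + (SUP b\<in>B. INF c\<in>C. d b c)" by simp
qed

lemma half_hausdorff_zero_imp_subset: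
  assumes A: "A \<in> closed_bounded_sets" and B: "B \<in> closed_bounded_sets"
    and z: "(SUP a\<in>A. INF b\<in>B. d a b) \<le> 0"
  shows "A \<subseteq> B"
proof
  fix a assume a: "a \<in> A"
  have ne: "B \<noteq> {}" and cl: "closedin mtopology B" using B by (auto simp: closed_bounded_sets_def)
  have aM: "a \<in> M" using a A closed_bounded_sets_subset by blast
  have "(INF b\<in>B. d a b) \<le> 0"
    using cSUP_upper[OF a bdd_above_INF_d[OF A B]] z by simp
  then have ex: "\<exists>b\<in>B. d a b < r" if "r > 0" for r
    using cINF_less_iff[OF ne bdd_below_d, of a r] that by simp
  show "a \<in> B"
  proof (rule ccontr)
    assume "a \<notin> B"
    with cl aM obtain r where "r > 0" "disjnt B (mball a r)"
      unfolding closedin_metric by blast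
    moreover from this ex obtain b where "b \<in> B" "d a b < r" by blast
    moreover have "b \<in> M" using \<open>b \<in> B\<close> B closed_bounded_sets_subset by blast
    ultimately show False using aM by (auto simp: disjnt_iff)
  qed
qed

lemma half_hausdorff_self:
  assumes A: "A \<in> closed_bounded_sets"
  shows "(SUP a\<in>A. INF b\<in>A. d a b) = 0"
proof -
  have ne: "A \<noteq> {}" using A by (auto simp: closed_bounded_sets_def)
  have "(INF b\<in>A. d a b) \<le> 0" if "a \<in> A" for a
    using that A closed_bounded_sets_subset[OF A] by (intro cINF_lower2[OF bdd_below_d, of a]) auto
  then have "(SUP a\<in>A. INF b\<in>A. d a b) \<le> 0" by (intro cSUP_least[OF ne])
  with half_hausdorff_nonneg[OF A A] show ?thesis by simp
qed

lemma Metric_space_closed_bounded_sets: "Metric_space closed_bounded_sets hausdorff_dist"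
proof
  fix A B :: "'a set"
  show "0 \<le> hausdorff_dist A B"
    by (auto simp: hausdorff_dist_def le_max_iff_disj intro: half_hausdorff_nonneg)
  show "hausdorff_dist A B = hausdorff_dist B A"
    by (simp add: hausdorff_dist_def commute max.commute)
next
  fix A B assume A: "A \<in> closed_bounded_sets" and B: "B \<in> closed_bounded_sets"
  show "hausdorff_dist A B = 0 \<longleftrightarrow> A = B"
  proof
    assume "hausdorff_dist A B = 0"
    then have "max (SUP a\<in>A. INF b\<in>B. d a b) (SUP b\<in>B. INF a\<in>A. d b a) \<le> 0"
      using A B by (simp add: hausdorff_dist_def commute)
    then show "A = B"
      by (intro equalityI half_hausdorff_zero_imp_subset A B) auto
  next
    assume "A = B"
    then show "hausdorff_dist A B = 0"
      using half_hausdorff_self[OF A] by (simp add: hausdorff_dist_def commute)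
  qed
next
  fix A B C
  assume A: "A \<in> closed_bounded_sets" and B: "B \<in> closed_bounded_sets" and C: "C \<in> closed_bounded_sets"
  have comm: "(SUP b\<in>Y. INF a\<in>X. d a b) = (SUP b\<in>Y. INF a\<in>X. d b a)" for X Y
    by (simp add: commute)
  show "hausdorff_dist A C \<le> hausdorff_dist A B + hausdorff_dist B C"
    using A B C half_hausdorff_triangle[OF A B C] half_hausdorff_triangle[OF C B A]
    unfolding hausdorff_dist_def comm by (simp add: max_def)
qed

lemma Metric_space_closed_balls: "Metric_space closed_balls hausdorff_dist"
  using Metric_space.subspace[OF Metric_space_closed_bounded_sets closed_balls_subset] .

end

end

theory Submission
  imports Defs
begin

text \<open>A ball with two points at distance \<open>s > 0\<close> is isolated: every ball at Hausdorff distance less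
  than \<open>s\<close> equals it. So local compactness of the space of balls only matters at singletons \<open>{x}\<close>,
  where the closed \<open>r\<close>-ball consists of the balls contained in \<open>mcball x r\<close>. If \<open>mcball x r\<close> is
  compact, an open cover of this set covers all sufficiently small balls by finitely many members,
  and the remaining balls are unions of members of a fixed finite family of balls, hence finite in
  number. Conversely, \<open>x \<mapsto> {x}\<close> is an isometry, and a limit \<open>B\<close> of singletons \<open>{x\<^sub>n}\<close> forces \<open>x\<^sub>n\<close> to
  converge to any point of \<open>B\<close>.\<close>

section \<open>Hausdorff distance between balls and singletons\<close>

context Metric_space
begin

lemma mcball_zero: "x \<in> M \<Longrightarrow> mcball x 0 = {x}"
  by (auto simp: antisym_conv[OF nonneg])

lemma singleton_in_closed_balls: "x \<in> M \<Longrightarrow> {x} \<in> closed_balls"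
  using mcball_zero[of x] by (force simp: closed_balls_def)

lemma closed_ballE:
  assumes "B \<in> closed_balls"
  obtains c r where "c \<in> M" "0 \<le> r" "B = mcball c r"
  using assms by (auto simp: closed_balls_def)

lemma closed_ball_nonempty: "B \<in> closed_balls \<Longrightarrow> B \<noteq> {}"
  by (auto simp: closed_balls_def)

lemma hausdorff_dist_less_imp_ex:
  assumes A: "A \<in> closed_bounded_sets" and B: "B \<in> closed_bounded_sets"
    and less: "hausdorff_dist A B < s" and a: "a \<in> A"
  shows "\<exists>b\<in>B. d a b < s"
proof -
  have "(INF b\<in>B. d a b) \<le> (SUP a\<in>A. INF b\<in>B. d a b)"
    by (rule cSUP_upper[OF a bdd_above_INF_d[OF A B]])
  with A B less have "(INF b\<in>B. d a b) < s"
    by (simp add: hausdorff_dist_def)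
  moreover have "B \<noteq> {}"
    using B by (simp add: closed_bounded_sets_def)
  ultimately show ?thesis
    using cINF_less_iff[OF _ bdd_below_d] by blast
qed

text \<open>One half of the maximum is the supremum of \<open>d x b\<close> over
  \<open>b \<in> B\<close>, the other is the infimum of the same numbers, so the maximum is the
  supremum.\<close>

lemma hausdorff_dist_singleton_le_iff:
  assumes x: "x \<in> M" and B: "B \<in> closed_bounded_sets"
  shows "hausdorff_dist {x} B \<le> r \<longleftrightarrow> B \<subseteq> mcball x r"
proof -
  have X: "{x} \<in> closed_bounded_sets"
    using singleton_in_closed_balls[OF x] closed_balls_subset by blast
  have ne: "B \<noteq> {}" and BM: "B \<subseteq> M"
    using B closed_bounded_sets_subset by (auto simp: closed_bounded_sets_def)
  have bdd: "bdd_above (d x ` B)"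
    using bdd_above_INF_d[OF B X] by (simp add: commute)
  obtain b where b: "b \<in> B" using ne by blast
  have "(INF b\<in>B. d x b) \<le> (SUP b\<in>B. d x b)"
    using cINF_lower[OF bdd_below_d b, of x] cSUP_upper[OF b bdd] by linarith
  then have "hausdorff_dist {x} B = (SUP b\<in>B. d x b)"
    using X B by (simp add: hausdorff_dist_def)
  also have "\<dots> \<le> r \<longleftrightarrow> (\<forall>b\<in>B. d x b \<le> r)"
    by (rule cSUP_le_iff[OF ne bdd])
  finally show ?thesis
    using x BM by auto
qed

end

section \<open>Geometry of closed balls in an ultrametric space\<close>

context Ultrametric_space
begin

text \<open>For showing that a ball of radius \<open>r\<close> absorbs whatever lies within
  \<open>r\<close> of one of its points, and that each of its points is a centre.\<close>

lemma ultrametric_le: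
  assumes "c \<in> M" "x \<in> M" "y \<in> M" "d c x \<le> r" "d x y \<le> r"
  shows "d c y \<le> r"
  using ultrametric[of c y x] assms by simp

text \<open>Both radii are at least \<open>d p q\<close>, so each ball absorbs every point nearer
  than \<open>d p q\<close> to one of its members; hence each ball contains the other.\<close>

lemma closed_ball_isolated:
  assumes A: "A \<in> closed_balls" and B: "B \<in> closed_balls"
    and pq: "p \<in> A" "q \<in> A" and less: "hausdorff_dist A B < d p q"
  shows "A = B"
proof
  let ?s = "d p q"
  note bounded = A[THEN subsetD[OF closed_balls_subset]] B[THEN subsetD[OF closed_balls_subset]]
  have near_B: "\<exists>b\<in>B. d a b < ?s" if "a \<in> A" for a
    using hausdorff_dist_less_imp_ex[OF bounded less that] .
  have near_A: "\<exists>a\<in>A. d b a < ?s" if "b \<in> B" for b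
    using hausdorff_dist_less_imp_ex[OF bounded(2,1) _ that] less
    by (simp add: Metric_space.commute[OF Metric_space_closed_bounded_sets])
  obtain c r where c: "c \<in> M" "A = mcball c r" using A by (rule closed_ballE)
  obtain b t where b: "b \<in> M" "B = mcball b t" using B by (rule closed_ballE)
  have "?s \<le> r"
    using ultrametric[of p q c] pq c by (auto simp: commute)
  show "B \<subseteq> A"
  proof
    fix x assume x: "x \<in> B"
    then obtain a where "a \<in> A" "d x a < ?s" using near_A by blast
    then show "x \<in> A"
      using ultrametric_le[of c a x r] \<open>?s \<le> r\<close> x b c by (auto simp: commute)
  qed
  obtain p' q' where p'q': "p' \<in> B" "d p p' < ?s" "q' \<in> B" "d q q' < ?s"
    using near_B pq by blast
  \<comment> \<open>On the path \<open>p\<close>, \<open>p'\<close>, \<open>q'\<close>,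
    \<open>q\<close> the outer steps are shorter than \<open>d p q\<close>, so the middle step must
    be at least that long.\<close>
  have "?s \<le> d p' q'"
    using ultrametric[of p q p'] ultrametric[of p' q q'] pq p'q' b c by (auto simp: commute)
  also have "\<dots> \<le> t"
    using ultrametric[of p' q' b] p'q' b by (auto simp: commute)
  finally have "?s \<le> t" .
  show "A \<subseteq> B"
  proof
    fix x assume x: "x \<in> A"
    then obtain y where "y \<in> B" "d x y < ?s" using near_B by blast
    then show "x \<in> B"
      using ultrametric_le[of b y x t] \<open>?s \<le> t\<close> x b c by (auto simp: commute)
  qed
qed

text \<open>Since \<open>b\<close> is a centre of \<open>B\<close>, a point \<open>y\<close> of the
  open ball outside \<open>B\<close> forces the radius of \<open>B\<close> below
  \<open>d b y < e\<close>, which keeps \<open>B\<close> inside the open ball.\<close>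

lemma closed_ball_subset_or_superset_mball:
  assumes B: "B \<in> closed_balls" and z: "z \<in> M" and meets: "b \<in> B" "b \<in> mball z e"
  shows "B \<subseteq> mball z e \<or> mball z e \<subseteq> B"
proof (rule disjCI)
  assume "\<not> mball z e \<subseteq> B"
  obtain c r where c: "c \<in> M" "B = mcball c r" using B by (rule closed_ballE)
  from \<open>\<not> mball z e \<subseteq> B\<close> obtain y where y: "y \<in> M" "d z y < e" "y \<notin> B"
    unfolding subset_iff in_mball by blast
  have "r < d b y"
    using ultrametric_le[of c b y r] meets c y by (auto simp: not_le[symmetric])
  also have "d b y < e"
    using ultrametric[of b y z] meets z y by (auto simp: commute)
  finally have "r < e" .
  show "B \<subseteq> mball z e"
  proof
    fix x assume x: "x \<in> B"
    then have "d b x \<le> r"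
      using ultrametric_le[of b c x r] meets c by (auto simp: commute)
    then show "x \<in> mball z e"
      using ultrametric[of z x b] \<open>r < e\<close> meets x c z by (auto simp: commute)
  qed
qed

section \<open>Compactness of the set of balls inside a compact set\<close>

lemma compactin_closed_balls_subset:
  assumes K: "compactin mtopology K"
  shows "compactin (Metric_space.mtopology closed_balls hausdorff_dist) {B \<in> closed_balls. B \<subseteq> K}"
proof -
  interpret H: Metric_space closed_balls hausdorff_dist
    by (rule Metric_space_closed_balls)
  have KM: "K \<subseteq> M" using compactin_subset_topspace[OF K] by simp
  let ?S = "{B \<in> closed_balls. B \<subseteq> K}"
  have "\<exists>\<F>. finite \<F> \<and> \<F> \<subseteq> \<U> \<and> ?S \<subseteq> \<Union>\<F>"
    if op: "\<And>U. U \<in> \<U> \<Longrightarrow> openin H.mtopology U" and cover: "?S \<subseteq> \<Union>\<U>" for \<U>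
  proof -
    \<comment> \<open>Take \<open>U\<close> to be a member of the cover containing
      \<open>{z}\<close>: balls inside a small \<open>mball z e\<close> are Hausdorff-close to
      \<open>{z}\<close> and fall into the same \<open>U\<close>.\<close>
    have "\<exists>U e. U \<in> \<U> \<and> 0 < e \<and> (\<forall>B\<in>closed_balls. B \<subseteq> mball z e \<longrightarrow> B \<in> U)" if z: "z \<in> K" for z
    proof -
      have zM: "z \<in> M" using z KM by blast
      have "{z} \<in> ?S" using z zM singleton_in_closed_balls by blast
      with cover obtain U where U: "U \<in> \<U>" "{z} \<in> U" by blast
      with op obtain e where e: "e > 0" "H.mcball {z} e \<subseteq> U"
        by (meson H.openin_mtopology_mcball)
      have "B \<in> U" if B: "B \<in> closed_balls" "B \<subseteq> mball z e" for B
      proof -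
        have "B \<in> closed_bounded_sets" using B(1) closed_balls_subset by blast
        moreover have "B \<subseteq> mcball z e" using B(2) mball_subset_mcball by blast
        ultimately have "hausdorff_dist {z} B \<le> e"
          using hausdorff_dist_singleton_le_iff[OF zM] by blast
        with B e show ?thesis using singleton_in_closed_balls[OF zM] by auto
      qed
      with U e show ?thesis by blast
    qed
    then obtain U e where Ue: "\<And>z. z \<in> K \<Longrightarrow> U z \<in> \<U>" "\<And>z. z \<in> K \<Longrightarrow> 0 < e z"
      "\<And>z B. \<lbrakk>z \<in> K; B \<in> closed_balls; B \<subseteq> mball z (e z)\<rbrakk> \<Longrightarrow> B \<in> U z"
      by metis
    let ?b = "\<lambda>z. mball z (e z)"
    have "K \<subseteq> \<Union>(?b ` K)"
      using Ue(2) KM by force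
    then obtain \<B> where \<B>: "finite \<B>" "\<B> \<subseteq> ?b ` K" "K \<subseteq> \<Union>\<B>"
      using compactinD[OF K, of "?b ` K"] by auto
    then obtain Z where Z: "finite Z" "Z \<subseteq> K" "K \<subseteq> \<Union>(?b ` Z)"
      using finite_subset_image[OF \<B>(1,2)] by blast
    \<comment> \<open>Balls that fit in no chosen neighbourhood may escape every \<open>U z\<close>
      with \<open>z \<in> Z\<close>; it remains to see that they are finitely many.\<close>
    let ?large = "{B \<in> ?S. \<forall>z\<in>Z. \<not> B \<subseteq> ?b z}"
    have "?large \<subseteq> Union ` Pow (?b ` Z)"
    proof
      fix B assume B: "B \<in> ?large"
      \<comment> \<open>A set \<open>?b z\<close> with \<open>z \<in> Z\<close> that meets
        \<open>B\<close> does not contain it, hence lies inside it. As these sets cover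
        \<open>B\<close>, a subfamily of a finite family determines \<open>B\<close>.\<close>
      have "B = \<Union>{V \<in> ?b ` Z. V \<subseteq> B}"
      proof
        show "B \<subseteq> \<Union>{V \<in> ?b ` Z. V \<subseteq> B}"
        proof
          fix x assume x: "x \<in> B"
          with B Z obtain z where z: "z \<in> Z" "x \<in> ?b z" by blast
          moreover have "?b z \<subseteq> B"
            using closed_ball_subset_or_superset_mball[of B z x "e z"] B x z Z KM by blast
          ultimately show "x \<in> \<Union>{V \<in> ?b ` Z. V \<subseteq> B}" by blast
        qed
      qed blast
      then show "B \<in> Union ` Pow (?b ` Z)" by blast
    qed
    then have fin: "finite ?large"
      by (rule finite_subset) (simp add: Z(1))
    \<comment> \<open>One member of the cover is picked per ball; only the picks for the finitely
      many large balls enter the subcover.\<close>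
    have "\<forall>B\<in>?S. \<exists>V. V \<in> \<U> \<and> B \<in> V" using cover by blast
    from bchoice[OF this] obtain W where W: "\<And>B. B \<in> ?S \<Longrightarrow> W B \<in> \<U> \<and> B \<in> W B"
      by blast
    show ?thesis
    proof (intro exI conjI)
      show "finite (U ` Z \<union> W ` ?large)" using Z(1) fin by blast
      show "U ` Z \<union> W ` ?large \<subseteq> \<U>" using Ue(1) Z(2) W by blast
      show "?S \<subseteq> \<Union>(U ` Z \<union> W ` ?large)"
      proof
        fix B assume B: "B \<in> ?S"
        show "B \<in> \<Union>(U ` Z \<union> W ` ?large)"
        proof (cases "B \<in> ?large")
          case True
          with W[OF B] show ?thesis by blast
        next
          case False
          with B obtain z where z: "z \<in> Z" "B \<subseteq> ?b z" by blast
          with B Ue(3) Z(2) have "B \<in> U z" by blast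
          with z show ?thesis by blast
        qed
      qed
    qed
  qed
  then show ?thesis
    unfolding compactin_def by auto
qed

section \<open>Transfer of local compactness in both directions\<close>

lemma locally_compact_closed_balls:
  assumes lc: locally_compact_metric
  shows "Metric_space.locally_compact_metric closed_balls hausdorff_dist"
proof -
  interpret H: Metric_space closed_balls hausdorff_dist
    by (rule Metric_space_closed_balls)
  have "\<exists>r>0. compactin H.mtopology (H.mcball A r)" if A: "A \<in> closed_balls" for A
  proof (cases "\<exists>p\<in>A. \<exists>q\<in>A. p \<noteq> q")
    case True
    then obtain p q where pq: "p \<in> A" "q \<in> A" "p \<noteq> q" by blast
    moreover have "A \<subseteq> M" using A by (auto simp: closed_balls_def)
    ultimately have pos: "0 < d p q" by (simp add: subset_iff)
    \<comment> \<open>Halving turns the non-strict bound of a closed ball into the strict bound that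
      isolation requires.\<close>
    have "H.mcball A (d p q / 2) = {A}"
      using closed_ball_isolated[OF A _ pq(1,2)] pos A by fastforce
    then have "compactin H.mtopology (H.mcball A (d p q / 2))" using A by simp
    with pos show ?thesis by (metis half_gt_zero)
  next
    case False
    with closed_ball_nonempty[OF A] obtain x where x: "A = {x}" by blast
    then have xM: "x \<in> M" using A by (auto simp: closed_balls_def)
    with lc obtain r where r: "r > 0" "compactin mtopology (mcball x r)"
      unfolding locally_compact_metric_def by blast
    have "H.mcball {x} r = {B \<in> closed_balls. B \<subseteq> mcball x r}"
      using hausdorff_dist_singleton_le_iff[OF xM] closed_balls_subset
        singleton_in_closed_balls[OF xM] by (auto simp: H.mcball_def)
    with compactin_closed_balls_subset[OF r(2)] r(1) x show ?thesis by metis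
  qed
  then show ?thesis unfolding H.locally_compact_metric_def by blast
qed

end

text \<open>Sequential compactness is pulled back along \<open>x \<mapsto> {x}\<close>. The limit
  \<open>B\<close> of singletons need not be identified: any \<open>b \<in> B\<close> is a limit of
  the underlying points.\<close>

lemma (in Metric_space) locally_compact_closed_balls_imp:
  assumes lc: "Metric_space.locally_compact_metric closed_balls hausdorff_dist"
  shows locally_compact_metric
  unfolding locally_compact_metric_def
proof
  interpret H: Metric_space closed_balls hausdorff_dist
    by (rule Metric_space_closed_balls)
  fix x assume x: "x \<in> M"
  then have "{x} \<in> closed_balls" by (rule singleton_in_closed_balls)
  with lc obtain r where r: "r > 0" "compactin H.mtopology (H.mcball {x} r)"
    unfolding H.locally_compact_metric_def by blast
  have mem_iff: "B \<in> H.mcball {x} r \<longleftrightarrow> B \<subseteq> mcball x r" if "B \<in> closed_balls" for B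
    using hausdorff_dist_singleton_le_iff[OF x, of B r] closed_balls_subset
      singleton_in_closed_balls[OF x] that by auto
  have "\<exists>l s. l \<in> mcball x r \<and> strict_mono s \<and> limitin mtopology (\<sigma> \<circ> s) l sequentially"
    if \<sigma>: "range \<sigma> \<subseteq> mcball x r" for \<sigma> :: "nat \<Rightarrow> 'a"
  proof -
    have \<sigma>M: "\<sigma> n \<in> M" for n using subsetD[OF \<sigma> rangeI[of \<sigma> n]] by simp
    have "range (\<lambda>n. {\<sigma> n}) \<subseteq> H.mcball {x} r"
      using \<sigma> \<sigma>M mem_iff singleton_in_closed_balls by blast
    then obtain B s where B: "B \<in> H.mcball {x} r" and s: "strict_mono s"
      and lim: "limitin H.mtopology ((\<lambda>n. {\<sigma> n}) \<circ> s) B sequentially"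
      using r(2) unfolding H.compactin_sequentially by meson
    have Bb: "B \<in> closed_balls" using B by auto
    then obtain b where b: "b \<in> B" using closed_ball_nonempty by blast
    have bx: "b \<in> mcball x r" using B b mem_iff[OF Bb] by blast
    \<comment> \<open>With the Hausdorff distance itself as radius, the singleton criterion puts all
      of \<open>B\<close>, in particular \<open>b\<close>, that close to
      \<open>\<sigma> n\<close>.\<close>
    have le: "d (\<sigma> n) b \<le> hausdorff_dist {\<sigma> n} B" for n
      using hausdorff_dist_singleton_le_iff[OF \<sigma>M[of n], of B "hausdorff_dist {\<sigma> n} B"]
        subsetD[OF closed_balls_subset Bb] b by (simp add: subset_iff)
    have "limitin mtopology (\<sigma> \<circ> s) b sequentially"
      unfolding limitin_metric
    proof (intro conjI allI impI)
      show "b \<in> M" using bx by simp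
      fix e :: real assume "e > 0"
      with lim have "\<forall>\<^sub>F n in sequentially. hausdorff_dist {\<sigma> (s n)} B < e"
        unfolding H.limitin_metric by (auto elim!: allE[of _ e] eventually_mono)
      then show "\<forall>\<^sub>F n in sequentially. (\<sigma> \<circ> s) n \<in> M \<and> d ((\<sigma> \<circ> s) n) b < e"
        by eventually_elim (use \<sigma>M le in \<open>auto intro: le_less_trans\<close>)
    qed
    with bx s show ?thesis by blast
  qed
  then have "compactin mtopology (mcball x r)"
    unfolding compactin_sequentially by auto
  with r(1) show "\<exists>r>0. compactin mtopology (mcball x r)" by blast
qed

theorem theorem5p14:
  fixes X :: "'a set" and d :: "'a \<Rightarrow> 'a \<Rightarrow> real"
  assumes "Ultrametric_space X d" and "X \<noteq> {}"
  shows "Metric_space.locally_compact_metric X d \<longleftrightarrow>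
    Metric_space.locally_compact_metric (Metric_space.closed_balls X d)
      (Metric_space.hausdorff_dist X d)"
proof -
  interpret Ultrametric_space X d by (rule assms(1))
  show ?thesis
    using locally_compact_closed_balls locally_compact_closed_balls_imp by blast
qed

end
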